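(* Let $G$ be a topological group and $H$ a covering group of $G$ with covering map $\varphi: H\to G$. Let $\mathcal{V}$ be a vector space over $\mathbb{F}$, let $\rho: G\to \mathrm{PGL}(\mathcal{V})$ be a projective representation of $G$, and let $\widehat\rho: H\to \mathrm{GL}(\mathcal{V})$ be a lift of $\rho$. Then for every $v\in \mathrm{P}(\mathcal{V})$ the following are equivalent: (i) $\rho(g)v = v$ in $\mathrm{P}(\mathcal{V})$ for all $g\in G$. (ii) There exist $\varepsilon\in H^*$ and a nonzero $x\in U^\varepsilon$ such that $v$ is the equivalence class of $x$ in $\mathrm{P}(\mathcal{V})$, where $U^\varepsilon = \{x\in\mathcal{V} : \widehat\rho(h)x = \varepsilon(h)x \text{ for all } h\in H\}$.
   Context: $\mathbb{F}$ denotes $\mathbb{R}$ or $\mathbb{C}$. $\mathrm{P}(\mathcal{V})$ is the set of equivalence classes of $\mathcal{V}\setminus\{0\}$ under $v\sim w \iff v=\lambda w$ for some $\lambda\in\mathbb{F}\setminus\{0\}$. $\mathrm{GL}(\mathcal{V})$ is the group of invertible linear maps $\mathcal{V}\to\mathcal{V}$, $\mathrm{PGL}(\mathcal{V})$ is its quotient by nonzero scalar multiples of the identity, and $\Pi_{\mathrm{GL}(\mathcal{V})}:\mathrm{GL}(\mathcal{V})\to\mathrm{PGL}(\mathcal{V})$ is the projection; $\mathrm{PGL}(\mathcal{V})$ acts on $\mathrm{P}(\mathcal{V})$ in the obvious way. A projective representation of $G$ on $\mathrm{P}(\mathcal{V})$ is a group homomorphism $\rho: G\to\mathrm{PGL}(\mathcal{V})$.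 A linear representation of a topological group $H$ on $\mathcal{V}$ is a continuous group homomorphism $\widehat\rho: H\to\mathrm{GL}(\mathcal{V})$, where continuity means that $h\mapsto\widehat\rho(h)x$ is continuous for every $x\in\mathcal{V}$; here $\mathcal{V}$ carries its usual topology if it is finite dimensional, and is a Hausdorff topological vector space in general. A topological group $H$ is a covering group of $G$ if there is a group covering (covering map) $\varphi: H\to G$, i.e. a surjective continuous group homomorphism which maps some neighbourhood of the unit element $e_H\in H$ homeomorphically onto a neighbourhood of the unit element $e_G\in G$. A lift of $\rho$ is a linear representation $\widehat\rho: H\to\mathrm{GL}(\mathcal{V})$ with $\rho\circ\varphi = \Pi_{\mathrm{GL}(\mathcal{V})}\circ\widehat\rho$. The character group $H^*$ is the set of continuous group homomorphisms $\varepsilon: H\to\mathbb{F}\setminus\{0\}$. *)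

theory Defs
  imports "HOL-Analysis.Analysis" "HOL-Algebra.Coset"
begin

section \<open>The ground field\<close>

text \<open>
  The type class of valued fields that are isometrically isomorphic to the reals or to the complex
  numbers; a type variable of this class renders \<open>\<bbbF> \<in> {\<real>, \<complex>}\<close>.
\<close>

class real_or_complex = real_normed_field +
  assumes real_or_complex:
    "(\<exists>f :: 'a \<Rightarrow> real. bij f \<and> (\<forall>x y. f (x + y) = f x + f y) \<and> (\<forall>x y. f (x * y) = f x * f y)
        \<and> (\<forall>x. norm (f x) = norm x)) \<or>
     (\<exists>f :: 'a \<Rightarrow> complex. bij f \<and> (\<forall>x y. f (x + y) = f x + f y) \<and> (\<forall>x y. f (x * y) = f x * f y)
        \<and> (\<forall>x. norm (f x) = norm x))"

instance real :: real_or_complex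
  by standard (rule disjI1, rule exI[of _ id], simp)

instance complex :: real_or_complex
  by standard (rule disjI2, rule exI[of _ id], simp)

text \<open>
  Hausdorff topological vector spaces. On a finite-dimensional space the usual topology is the only
  such topology, so this also covers the finite-dimensional convention.
\<close>

locale hausdorff_tvs = vector_space smul
  for smul :: "'k::real_or_complex \<Rightarrow> 'v::{topological_ab_group_add, t2_space} \<Rightarrow> 'v" +
  assumes continuous_scale: "continuous_on UNIV (\<lambda>(a, x). smul a x)"


section \<open>Projective spaces and linear groups\<close>

definition proj_rel :: "('k::field \<Rightarrow> 'v::ab_group_add \<Rightarrow> 'v) \<Rightarrow> ('v \<times> 'v) set" where
  "proj_rel smul = {(x, y). x \<noteq> 0 \<and> y \<noteq> 0 \<and> (\<exists>c. c \<noteq> 0 \<and> x = smul c y)}"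

definition proj_space :: "('k::field \<Rightarrow> 'v::ab_group_add \<Rightarrow> 'v) \<Rightarrow> 'v set set" where
  "proj_space smul = (UNIV - {0}) // proj_rel smul"

definition proj_class :: "('k::field \<Rightarrow> 'v::ab_group_add \<Rightarrow> 'v) \<Rightarrow> 'v \<Rightarrow> 'v set" where
  "proj_class smul x = proj_rel smul `` {x}"

definition GL :: "('k::field \<Rightarrow> 'v::ab_group_add \<Rightarrow> 'v) \<Rightarrow> ('v \<Rightarrow> 'v) monoid" where
  "GL smul = \<lparr>carrier = {f. Vector_Spaces.linear smul smul f \<and> bij f},
               monoid.mult = (\<circ>), one = id\<rparr>"

definition scalar_maps :: "('k::field \<Rightarrow> 'v::ab_group_add \<Rightarrow> 'v) \<Rightarrow> ('v \<Rightarrow> 'v) set" where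
  "scalar_maps smul = {smul c | c. c \<noteq> 0}"

definition PGL :: "('k::field \<Rightarrow> 'v::ab_group_add \<Rightarrow> 'v) \<Rightarrow> ('v \<Rightarrow> 'v) set monoid" where
  "PGL smul = GL smul Mod scalar_maps smul"

definition GL_proj :: "('k::field \<Rightarrow> 'v::ab_group_add \<Rightarrow> 'v) \<Rightarrow> ('v \<Rightarrow> 'v) \<Rightarrow> ('v \<Rightarrow> 'v) set" where
  "GL_proj smul f = scalar_maps smul #>\<^bsub>GL smul\<^esub> f"

text \<open>
  Elements of the projective linear group and points of projective space are sets; the action is
  elementwise. Lemma \<open>pgl_act_GL_proj\<close> below confirms that it maps the class of \<open>x\<close> under
  the class of \<open>f\<close> to the class of \<open>f x\<close>.
\<close>

definition pgl_act :: "('v \<Rightarrow> 'v) set \<Rightarrow> 'v set \<Rightarrow> 'v set" where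
  "pgl_act C v = {f x | f x. f \<in> C \<and> x \<in> v}"


section \<open>Topological groups, coverings and representations\<close>

locale topological_group = group G for G (structure) +
  fixes T
  assumes topspace_eq: "topspace T = carrier G"
    and continuous_mult: "continuous_map (prod_topology T T) T (\<lambda>(x, y). x \<otimes> y)"
    and continuous_inv: "continuous_map T T (\<lambda>x. inv x)"

text \<open>
  A neighbourhood of a point is a set, not necessarily open, whose interior contains the point.
\<close>

definition group_covering ::
    "('h, 'm) monoid_scheme \<Rightarrow> 'h topology \<Rightarrow> ('g, 'n) monoid_scheme \<Rightarrow> 'g topology \<Rightarrow> ('h \<Rightarrow> 'g) \<Rightarrow> bool"
  where
  "group_covering H TH G TG \<phi> \<longleftrightarrow>
     \<phi> \<in> hom H G \<and> \<phi> ` carrier H = carrier G \<and> continuous_map TH TG \<phi> \<and>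
     (\<exists>U W. U \<subseteq> carrier H \<and> W \<subseteq> carrier G
        \<and> \<one>\<^bsub>H\<^esub> \<in> TH interior_of U \<and> \<one>\<^bsub>G\<^esub> \<in> TG interior_of W
        \<and> homeomorphic_map (subtopology TH U) (subtopology TG W) \<phi>)"

definition projective_representation ::
    "('g, 'm) monoid_scheme \<Rightarrow> ('k::field \<Rightarrow> 'v::ab_group_add \<Rightarrow> 'v) \<Rightarrow> ('g \<Rightarrow> ('v \<Rightarrow> 'v) set) \<Rightarrow> bool"
  where
  "projective_representation G smul \<rho> \<longleftrightarrow> \<rho> \<in> hom G (PGL smul)"

definition linear_representation ::
    "('h, 'm) monoid_scheme \<Rightarrow> 'h topology
      \<Rightarrow> ('k::field \<Rightarrow> 'v::{ab_group_add, topological_space} \<Rightarrow> 'v) \<Rightarrow> ('h \<Rightarrow> 'v \<Rightarrow> 'v) \<Rightarrow> bool"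
  where
  "linear_representation H TH smul \<sigma> \<longleftrightarrow>
     \<sigma> \<in> hom H (GL smul) \<and> (\<forall>x. continuous_map TH euclidean (\<lambda>h. \<sigma> h x))"

definition is_lift ::
    "('h, 'm) monoid_scheme \<Rightarrow> 'h topology \<Rightarrow> ('h \<Rightarrow> 'g)
      \<Rightarrow> ('k::field \<Rightarrow> 'v::{ab_group_add, topological_space} \<Rightarrow> 'v)
      \<Rightarrow> ('g \<Rightarrow> ('v \<Rightarrow> 'v) set) \<Rightarrow> ('h \<Rightarrow> 'v \<Rightarrow> 'v) \<Rightarrow> bool"
  where
  "is_lift H TH \<phi> smul \<rho> \<sigma> \<longleftrightarrow>
     linear_representation H TH smul \<sigma> \<and> (\<forall>h\<in>carrier H. \<rho> (\<phi> h) = GL_proj smul (\<sigma> h))"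

definition field_units :: "'k::field monoid" where
  "field_units = \<lparr>carrier = UNIV - {0}, monoid.mult = (*), one = 1\<rparr>"

definition character_group :: "('h, 'm) monoid_scheme \<Rightarrow> 'h topology \<Rightarrow> ('h \<Rightarrow> 'k::real_or_complex) set" where
  "character_group H TH =
     {\<epsilon>. \<epsilon> \<in> hom H field_units \<and> continuous_map TH (top_of_set (UNIV - {0})) \<epsilon>}"

definition character_space ::
    "('h, 'm) monoid_scheme \<Rightarrow> ('k::field \<Rightarrow> 'v::ab_group_add \<Rightarrow> 'v) \<Rightarrow> ('h \<Rightarrow> 'v \<Rightarrow> 'v) \<Rightarrow> ('h \<Rightarrow> 'k)
      \<Rightarrow> 'v set" where
  "character_space H smul \<sigma> \<epsilon> = {x. \<forall>h\<in>carrier H. \<sigma> h x = smul (\<epsilon> h) x}"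


section \<open>Basic facts about the linear groups\<close>

context vector_space
begin

lemma equiv_proj_rel: "equiv (UNIV - {0}) (proj_rel scale)"
proof (rule equivI)
  show "refl_on (UNIV - {0}) (proj_rel scale)"
    by (auto simp: refl_on_def proj_rel_def intro!: exI[of _ 1])
  show "proj_rel scale \<subseteq> (UNIV - {0}) \<times> (UNIV - {0})"
    by (auto simp: proj_rel_def)
  show "sym (proj_rel scale)"
  proof (rule symI)
    fix x y assume "(x, y) \<in> proj_rel scale"
    then obtain c where c: "x \<noteq> 0" "y \<noteq> 0" "c \<noteq> 0" "x = scale c y"
      by (auto simp: proj_rel_def)
    hence "y = scale (inverse c) x" by simp
    with c show "(y, x) \<in> proj_rel scale"
      using nonzero_imp_inverse_nonzero unfolding proj_rel_def by blast
  qed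
  show "trans (proj_rel scale)"
  proof (rule transI)
    fix x y z assume "(x, y) \<in> proj_rel scale" "(y, z) \<in> proj_rel scale"
    then obtain c d where "x \<noteq> 0" "z \<noteq> 0" "c \<noteq> 0" "d \<noteq> 0" "x = scale (c * d) z"
      by (auto simp: proj_rel_def)
    thus "(x, z) \<in> proj_rel scale"
      unfolding proj_rel_def using no_zero_divisors by blast
  qed
qed

lemma mem_proj_class: "x \<noteq> 0 \<Longrightarrow> y \<in> proj_class scale x \<longleftrightarrow> (\<exists>c. c \<noteq> 0 \<and> y = scale c x)"
proof -
  assume x: "x \<noteq> 0"
  have "(x, y) \<in> proj_rel scale \<longleftrightarrow> (y, x) \<in> proj_rel scale"
    using equiv_proj_rel by (meson equivE symE)
  with x show ?thesis by (auto simp: proj_class_def proj_rel_def)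
qed

lemma group_GL: "group (GL scale)"
proof (rule groupI)
  fix f assume f: "f \<in> carrier (GL scale)"
  have b: "bij f" and l: "Vector_Spaces.linear scale scale f"
    using f by (auto simp: GL_def)
  interpret f: Vector_Spaces.linear scale scale f by (rule l)
  have "Vector_Spaces.linear scale scale (inv_into UNIV f)"
    unfolding Vector_Spaces.linear_iff
  proof (intro conjI allI)
    show "vector_space scale" "vector_space scale" by unfold_locales
    fix x y c
    show "inv_into UNIV f (x + y) = inv_into UNIV f x + inv_into UNIV f y"
      using b by (metis bij_inv_eq_iff f.add)
    show "inv_into UNIV f (scale c x) = scale c (inv_into UNIV f x)"
      using b by (metis bij_inv_eq_iff f.scale)
  qed
  moreover have "inv_into UNIV f \<circ> f = id"
    using b by (simp add: bij_is_inj)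
  ultimately show "\<exists>g\<in>carrier (GL scale). g \<otimes>\<^bsub>GL scale\<^esub> f = \<one>\<^bsub>GL scale\<^esub>"
    using b by (auto simp: GL_def bij_imp_bij_inv)
qed (auto simp: GL_def linear_id Vector_Spaces.linear_compose bij_comp comp_assoc)

lemma scale_in_GL: assumes "c \<noteq> 0" shows "scale c \<in> carrier (GL scale)"
proof -
  have "bij (scale c)"
    by (rule o_bij[of "scale (inverse c)"]) (use assms in auto)
  thus ?thesis by (simp add: GL_def linear_scale_self)
qed

lemma normal_scalar_maps: "scalar_maps scale \<lhd> GL scale"
proof -
  interpret GL: group "GL scale" by (rule group_GL)
  have inv: "inv\<^bsub>GL scale\<^esub> (scale c) = scale (inverse c)" if "c \<noteq> 0" for c
    by (rule GL.inv_equality) (use that scale_in_GL in \<open>auto simp: GL_def\<close>)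
  have "subgroup (scalar_maps scale) (GL scale)"
  proof (rule GL.subgroupI)
    show "scalar_maps scale \<subseteq> carrier (GL scale)"
      using scale_in_GL by (auto simp: scalar_maps_def)
    show "scalar_maps scale \<noteq> {}"
      by (auto simp: scalar_maps_def intro: exI[of _ 1])
    show "inv\<^bsub>GL scale\<^esub> f \<in> scalar_maps scale" if f: "f \<in> scalar_maps scale" for f
    proof -
      from f obtain c where "c \<noteq> 0" "f = scale c" by (auto simp: scalar_maps_def)
      with inv[of c] show ?thesis
        unfolding scalar_maps_def using nonzero_imp_inverse_nonzero by blast
    qed
    show "f \<otimes>\<^bsub>GL scale\<^esub> g \<in> scalar_maps scale"
      if "f \<in> scalar_maps scale" "g \<in> scalar_maps scale" for f g
    proof -
      from that obtain c d where "c \<noteq> 0" "d \<noteq> 0" "f = scale c" "g = scale d"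
        by (auto simp: scalar_maps_def)
      hence "c * d \<noteq> 0" "f \<otimes>\<^bsub>GL scale\<^esub> g = scale (c * d)"
        by (auto simp: GL_def)
      thus ?thesis unfolding scalar_maps_def by blast
    qed
  qed
  moreover have "f \<otimes>\<^bsub>GL scale\<^esub> g \<otimes>\<^bsub>GL scale\<^esub> inv\<^bsub>GL scale\<^esub> f \<in> scalar_maps scale"
    if f: "f \<in> carrier (GL scale)" and g: "g \<in> scalar_maps scale" for f g
  proof -
    from g obtain c where c: "c \<noteq> 0" "g = scale c" by (auto simp: scalar_maps_def)
    interpret f: Vector_Spaces.linear scale scale f using f by (simp add: GL_def)
    have "f \<otimes>\<^bsub>GL scale\<^esub> g = g \<otimes>\<^bsub>GL scale\<^esub> f"
      using c by (auto simp: GL_def f.scale)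
    hence "f \<otimes>\<^bsub>GL scale\<^esub> g \<otimes>\<^bsub>GL scale\<^esub> inv\<^bsub>GL scale\<^esub> f = g"
      using f c scale_in_GL[of c] by (simp add: GL.m_assoc)
    thus ?thesis using g by simp
  qed
  ultimately show ?thesis by (simp add: GL.normal_inv_iff)
qed

lemma GL_proj_hom: "GL_proj scale \<in> hom (GL scale) (PGL scale)"
  using normal.r_coset_hom_Mod[OF normal_scalar_maps]
  by (simp add: PGL_def GL_proj_def[abs_def])

lemma pgl_act_GL_proj:
  assumes f: "f \<in> carrier (GL scale)" and x: "x \<noteq> 0"
  shows "pgl_act (GL_proj scale f) (proj_class scale x) = proj_class scale (f x)"
proof -
  interpret f: Vector_Spaces.linear scale scale f using f by (simp add: GL_def)
  have "inj f" using f by (simp add: GL_def bij_is_inj)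
  hence fx: "f x \<noteq> 0"
    using x f.zero by (metis injD)
  show ?thesis
  proof (intro Set.set_eqI iffI)
    fix y assume "y \<in> pgl_act (GL_proj scale f) (proj_class scale x)"
    then obtain c d where "c \<noteq> 0" "d \<noteq> 0" "y = scale c (f (scale d x))"
      using x by (auto simp: pgl_act_def GL_proj_def r_coset_def scalar_maps_def mem_proj_class GL_def)
    hence "c * d \<noteq> 0" "y = scale (c * d) (f x)" by (auto simp: f.scale)
    thus "y \<in> proj_class scale (f x)" using fx mem_proj_class by blast
  next
    fix y assume "y \<in> proj_class scale (f x)"
    then obtain c where c: "c \<noteq> 0" "y = scale c (f x)" using fx mem_proj_class by blast
    have "scale c \<circ> f \<in> GL_proj scale f"
      using c(1) by (auto simp: GL_proj_def r_coset_def scalar_maps_def GL_def)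
    moreover have "x \<in> proj_class scale x"
      using x mem_proj_class scale_one one_neq_zero by metis
    ultimately show "y \<in> pgl_act (GL_proj scale f) (proj_class scale x)"
      unfolding pgl_act_def using c(2) by (intro CollectI exI[of _ "scale c \<circ> f"] exI[of _ x]) simp
  qed
qed

end

end

theory Submission
  imports Defs
begin

text \<open>
  A fixed point of the action is a common eigenline of all \<open>\<rho>hat h\<close>, and the eigenvalues form a
  homomorphism to the nonzero scalars. Only its continuity needs an argument: in a Hausdorff
  topological vector space, the map \<open>c \<mapsto> c x\<close> is a homeomorphism onto its image when
  \<open>x \<noteq> 0\<close>, so continuity of \<open>h \<mapsto> \<rho>hat h x\<close> passes to the eigenvalue.
\<close>

context vector_space
begin

lemma proj_class_scale:
  assumes "c \<noteq> 0" "x \<noteq> 0"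
  shows "proj_class scale (scale c x) = proj_class scale x"
proof -
  have "(scale c x, x) \<in> proj_rel scale"
    using assms by (auto simp: proj_rel_def)
  thus ?thesis
    unfolding proj_class_def by (rule equiv_class_eq[OF equiv_proj_rel])
qed

lemma proj_class_self: "x \<noteq> 0 \<Longrightarrow> x \<in> proj_class scale x"
  using mem_proj_class scale_one one_neq_zero by metis

lemma GL_nonzero:
  assumes "f \<in> carrier (GL scale)" "x \<noteq> 0"
  shows "f x \<noteq> 0"
proof -
  interpret f: Vector_Spaces.linear scale scale f using assms by (simp add: GL_def)
  have "inj f" using assms by (simp add: GL_def bij_is_inj)
  thus ?thesis using assms f.zero by (metis injD)
qed

lemma proj_class_eq_iff:
  assumes "x \<noteq> 0" "y \<noteq> 0"
  shows "proj_class scale y = proj_class scale x \<longleftrightarrow> (\<exists>c. c \<noteq> 0 \<and> y = scale c x)"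
  using assms proj_class_self[of y] mem_proj_class[of x y] proj_class_scale by metis

text \<open>Turns a fixed point into an eigenvector: the class of \<open>x\<close> goes to the class
  of \<open>f x\<close>, and two classes agree exactly when their representatives are
  proportional.\<close>

lemma pgl_act_GL_proj_fixed_iff:
  assumes "f \<in> carrier (GL scale)" "x \<noteq> 0"
  shows "pgl_act (GL_proj scale f) (proj_class scale x) = proj_class scale x \<longleftrightarrow>
         (\<exists>c. c \<noteq> 0 \<and> f x = scale c x)"
  using assms by (simp add: pgl_act_GL_proj proj_class_eq_iff GL_nonzero)

text \<open>Since \<open>x\<close> is nonzero, a scalar is determined by its multiple of
  \<open>x\<close>, so evaluating the image of a product at \<open>x\<close> in two ways gives
  multiplicativity. \<open>H\<close> is not assumed to be a group here, hence the explicit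
  \<open>closed\<close>.\<close>

lemma eigenvalue_hom:
  assumes x: "x \<noteq> 0" and hom: "\<sigma> \<in> hom H (GL scale)"
    and \<epsilon>: "\<And>h. h \<in> carrier H \<Longrightarrow> \<epsilon> h \<noteq> 0 \<and> \<sigma> h x = scale (\<epsilon> h) x"
    and closed: "\<And>a b. a \<in> carrier H \<Longrightarrow> b \<in> carrier H \<Longrightarrow> a \<otimes>\<^bsub>H\<^esub> b \<in> carrier H"
  shows "\<epsilon> \<in> hom H field_units"
proof (rule homI)
  fix a b assume a: "a \<in> carrier H" and b: "b \<in> carrier H"
  have "\<sigma> a \<in> carrier (GL scale)" using hom a by (rule hom_in_carrier)
  then interpret \<sigma>: Vector_Spaces.linear scale scale "\<sigma> a" by (simp add: GL_def)
  have "scale (\<epsilon> (a \<otimes>\<^bsub>H\<^esub> b)) x = \<sigma> (a \<otimes>\<^bsub>H\<^esub> b) x"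
    using \<epsilon> closed a b by simp
  also have "\<dots> = \<sigma> a (\<sigma> b x)"
    using hom_mult[OF hom a b] by (simp add: GL_def)
  also have "\<dots> = scale (\<epsilon> a * \<epsilon> b) x"
    using \<epsilon> a b by (simp add: \<sigma>.scale mult.commute)
  finally show "\<epsilon> (a \<otimes>\<^bsub>H\<^esub> b) = \<epsilon> a \<otimes>\<^bsub>field_units\<^esub> \<epsilon> b"
    using x by (simp add: field_units_def)
qed (use \<epsilon> in \<open>simp add: field_units_def\<close>)

end

context hausdorff_tvs
begin

text \<open>
  A neighbourhood \<open>W\<close> of the origin such that \<open>b y \<in> U\<close> for all \<open>y \<in> W\<close> and small \<open>b\<close>, with \<open>U\<close>
  missing \<open>x\<close>, cannot contain \<open>c x\<close> for large \<open>c\<close>: otherwise \<open>x = (1/c) (c x) \<in> U\<close>.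
\<close>

lemma bounded_scalars_of_nhd:
  assumes "x \<noteq> 0"
  obtains W B where "open W" "0 \<in> W" "\<And>c. smul c x \<in> W \<Longrightarrow> norm c \<le> B"
proof -
  obtain U where U: "open U" "0 \<in> U" "x \<notin> U"
    using assms by (metis separation_t1)
  have "open ((\<lambda>(a, y). smul a y) -` U)"
    using continuous_scale U(1) by (simp add: continuous_on_open_vimage)
  moreover have "(0, 0) \<in> (\<lambda>(a, y). smul a y) -` U" using U(2) by simp
  ultimately obtain A W where AW: "open A" "open W" "(0, 0) \<in> A \<times> W"
      and sub: "A \<times> W \<subseteq> (\<lambda>(a, y). smul a y) -` U"
    by (rule open_prod_elim)
  obtain d where d: "d > 0" "ball 0 d \<subseteq> A"
    using AW by (auto elim: openE)
  have "norm c \<le> 1 / d" if c: "smul c x \<in> W" for c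
  proof (rule ccontr)
    assume n: "\<not> norm c \<le> 1 / d"
    have "norm c > 0" using n d by (smt (verit) divide_pos_pos)
    hence c0: "c \<noteq> 0" by simp
    have "norm (inverse c) < d"
      using n d c0 by (simp add: nonzero_norm_inverse) (simp add: field_simps)
    hence "inverse c \<in> A" using d by auto
    hence "smul (inverse c) (smul c x) \<in> U" using sub c by auto
    thus False using c0 U(3) by simp
  qed
  thus thesis using AW by (intro that) auto
qed

text \<open>Rescaling upgrades boundedness to smallness: multiplication by a large fixed
  \<open>k\<close> preserves the limit 0, so eventually \<open>k * f i\<close> obeys the bound
  \<open>B\<close>, which forces \<open>f i\<close> to be small.\<close>

lemma tendsto_scalar_zero:
  assumes x: "x \<noteq> 0" and lim: "((\<lambda>i. smul (f i) x) \<longlongrightarrow> 0) F"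
  shows "(f \<longlongrightarrow> 0) F"
proof (rule tendstoI)
  fix e :: real assume e: "e > 0"
  obtain W B where W: "open W" "0 \<in> W" "\<And>c. smul c x \<in> W \<Longrightarrow> norm c \<le> B"
    using bounded_scalars_of_nhd[OF x] by metis
  have B: "B \<ge> 0" using W(3)[of 0] W(2) by simp
  \<comment> \<open>Chosen so that \<open>B / norm k = B * e / (B + 1) < e\<close>; the summand 1
    keeps \<open>k\<close> nonzero when \<open>B = 0\<close>.\<close>
  define k :: 'k where "k = of_real ((B + 1) / e)"
  have cont: "continuous_on UNIV (\<lambda>y. smul k y)"
    using continuous_on_compose2[OF continuous_scale, of UNIV "\<lambda>y. (k, y)"]
    by (simp add: continuous_intros)
  hence "isCont (\<lambda>y. smul k y) 0" by (simp add: continuous_on_eq_continuous_at)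
  hence "((\<lambda>i. smul k (smul (f i) x)) \<longlongrightarrow> smul k 0) F"
    using lim by (rule isCont_tendsto_compose)
  hence "eventually (\<lambda>i. smul (k * f i) x \<in> W) F"
    using W(1,2) by (simp add: tendsto_def)
  thus "eventually (\<lambda>i. dist (f i) 0 < e) F"
  proof eventually_elim
    case (elim i)
    hence "norm (k * f i) \<le> B" by (rule W(3))
    moreover have "norm k = (B + 1) / e" unfolding k_def norm_of_real using e B by simp
    ultimately have "(B + 1) / e * norm (f i) \<le> B" by (simp add: norm_mult)
    hence "(B + 1) * norm (f i) \<le> B * e" using e by (simp add: field_simps)
    also have "\<dots> < (B + 1) * e" using e by (simp add: algebra_simps)
    finally show ?case using B by simp
  qed
qed

text \<open>Translation by \<open>- smul a x\<close> reduces this to limit 0. The filter is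
  arbitrary so that it can later be the punctured neighbourhoods of a point in an abstract
  topology.\<close>

lemma tendsto_scalar:
  assumes "x \<noteq> 0" and lim: "((\<lambda>i. smul (f i) x) \<longlongrightarrow> smul a x) F"
  shows "(f \<longlongrightarrow> a) F"
proof -
  have "((\<lambda>i. smul (f i) x + - smul a x) \<longlongrightarrow> smul a x + - smul a x) F"
    by (intro tendsto_add lim tendsto_const)
  hence "((\<lambda>i. smul (f i - a) x) \<longlongrightarrow> 0) F" by (simp add: scale_left_diff_distrib)
  hence "((\<lambda>i. f i - a) \<longlongrightarrow> 0) F" using assms(1) by (intro tendsto_scalar_zero)
  thus ?thesis by (rule LIM_zero_cancel)
qed

lemma continuous_map_scalar:
  assumes "x \<noteq> 0" and "continuous_map T euclidean (\<lambda>h. smul (f h) x)"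
  shows "continuous_map T euclidean f"
  using assms by (auto simp: continuous_map_atin intro: tendsto_scalar)

end

theorem theorem1p15:
  fixes G :: "('g, 'm) monoid_scheme" and TG :: "'g topology"
    and H :: "('h, 'n) monoid_scheme" and TH :: "'h topology"
    and \<phi> :: "'h \<Rightarrow> 'g"
    and smul :: "'k::real_or_complex \<Rightarrow> 'v::{topological_ab_group_add, t2_space} \<Rightarrow> 'v"
    and \<rho> :: "'g \<Rightarrow> ('v \<Rightarrow> 'v) set" and \<rho>hat :: "'h \<Rightarrow> 'v \<Rightarrow> 'v"
    and v :: "'v set"
  assumes "topological_group G TG"
    and "topological_group H TH"
    and "group_covering H TH G TG \<phi>"
    and "hausdorff_tvs smul"
    and "projective_representation G smul \<rho>"
    and "is_lift H TH \<phi> smul \<rho> \<rho>hat"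
    and "v \<in> proj_space smul"
  shows "(\<forall>g\<in>carrier G. pgl_act (\<rho> g) v = v) \<longleftrightarrow>
         (\<exists>\<epsilon>\<in>character_group H TH. \<exists>x\<in>character_space H smul \<rho>hat \<epsilon>.
            x \<noteq> 0 \<and> v = proj_class smul x)"
proof -
  interpret V: hausdorff_tvs smul by fact
  interpret H: topological_group H TH by fact
  have hom: "\<rho>hat \<in> hom H (GL smul)"
    and cont: "\<And>x. continuous_map TH euclidean (\<lambda>h. \<rho>hat h x)"
    and lift: "\<And>h. h \<in> carrier H \<Longrightarrow> \<rho> (\<phi> h) = GL_proj smul (\<rho>hat h)"
    using assms(6) by (auto simp: is_lift_def linear_representation_def)
  have surj: "carrier G = \<phi> ` carrier H"
    using assms(3) by (simp add: group_covering_def)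
  have GL: "\<And>h. h \<in> carrier H \<Longrightarrow> \<rho>hat h \<in> carrier (GL smul)"
    using hom by (rule hom_in_carrier)
  \<comment> \<open>Surjectivity of \<open>\<phi>\<close> moves the quantifier from \<open>G\<close>
    to \<open>H\<close>, where the lift supplies linear representatives. Both directions use
    this.\<close>
  have fixed_iff: "(\<forall>g\<in>carrier G. pgl_act (\<rho> g) (proj_class smul x) = proj_class smul x) \<longleftrightarrow>
      (\<forall>h\<in>carrier H. \<exists>c. c \<noteq> 0 \<and> \<rho>hat h x = smul c x)" if "x \<noteq> 0" for x
    using that by (simp add: surj lift GL V.pgl_act_GL_proj_fixed_iff)
  show ?thesis
  proof
    assume inv: "\<forall>g\<in>carrier G. pgl_act (\<rho> g) v = v"
    obtain x where x: "x \<noteq> 0" "v = proj_class smul x"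
      using assms(7) by (auto simp: proj_space_def proj_class_def elim: quotientE)
    then obtain \<epsilon> where \<epsilon>: "\<And>h. h \<in> carrier H \<Longrightarrow> \<epsilon> h \<noteq> 0 \<and> \<rho>hat h x = smul (\<epsilon> h) x"
      using inv fixed_iff[OF x(1)] by metis
    \<comment> \<open>The chosen \<open>\<epsilon>\<close> is controlled only on
      \<open>carrier H\<close>; this suffices because that is the whole space of
      \<open>TH\<close>.\<close>
    have "continuous_map TH euclidean (\<lambda>h. smul (\<epsilon> h) x)"
      using cont[of x] by (rule continuous_map_eq) (simp add: \<epsilon> H.topspace_eq)
    hence "continuous_map TH euclidean \<epsilon>"
      using x(1) by (intro V.continuous_map_scalar)
    hence "continuous_map TH (top_of_set (UNIV - {0})) \<epsilon>"
      using \<epsilon> by (auto simp: continuous_map_in_subtopology H.topspace_eq)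
    moreover have "\<epsilon> \<in> hom H field_units"
      using x(1) hom \<epsilon> by (rule V.eigenvalue_hom) simp_all
    ultimately have "\<epsilon> \<in> character_group H TH" by (simp add: character_group_def)
    moreover have "x \<in> character_space H smul \<rho>hat \<epsilon>"
      using \<epsilon> by (simp add: character_space_def)
    ultimately show "\<exists>\<epsilon>\<in>character_group H TH. \<exists>x\<in>character_space H smul \<rho>hat \<epsilon>.
        x \<noteq> 0 \<and> v = proj_class smul x"
      using x by blast
  next
    assume "\<exists>\<epsilon>\<in>character_group H TH. \<exists>x\<in>character_space H smul \<rho>hat \<epsilon>.
        x \<noteq> 0 \<and> v = proj_class smul x"
    then obtain \<epsilon> x where \<epsilon>: "\<epsilon> \<in> hom H (field_units :: 'k monoid)"
        "\<forall>h\<in>carrier H. \<rho>hat h x = smul (\<epsilon> h) x" and x: "x \<noteq> 0" "v = proj_class smul x"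
      by (auto simp: character_group_def character_space_def)
    \<comment> \<open>Proportionality in projective space needs a nonzero factor; it comes from the
      codomain of the character.\<close>
    have "\<And>h. h \<in> carrier H \<Longrightarrow> \<epsilon> h \<noteq> 0"
      using hom_in_carrier[OF \<epsilon>(1)] by (simp add: field_units_def)
    with \<epsilon>(2) show "\<forall>g\<in>carrier G. pgl_act (\<rho> g) v = v"
      unfolding x(2) fixed_iff[OF x(1)] by blast
  qed
qed

end
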